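(* Let $A$ be an $N\times N$ essential nonnegative integral matrix. The pair $(\mathbb Z^N/(\mathrm{id}-A)\mathbb Z^N\otimes\mathbb Z^N/(\mathrm{id}-A^t)\mathbb Z^N,\ e_A)$ is invariant under shift equivalence: if $B$ is an $M\times M$ essential nonnegative integral matrix that is shift equivalent to $A$, then there is a group isomorphism $$\mathbb Z^N/(\mathrm{id}-A)\mathbb Z^N\otimes\mathbb Z^N/(\mathrm{id}-A^t)\mathbb Z^N\longrightarrow\mathbb Z^M/(\mathrm{id}-B)\mathbb Z^M\otimes\mathbb Z^M/(\mathrm{id}-B^t)\mathbb Z^M$$ carrying $e_A$ to $e_B$.
   Context: A nonnegative integral matrix is a square matrix with entries in the nonnegative integers; it is essential if none of its rows or columns is the zero vector. With $e_i$ the $i$-th standard basis column vector and $[\cdot]$ the class in the quotient, $e_A=\sum_{i=1}^N[e_i]\otimes[e_i]\in\mathbb Z^N/(\mathrm{id}-A)\mathbb Z^N\otimes\mathbb Z^N/(\mathrm{id}-A^t)\mathbb Z^N$ (similarly $e_B$). Tensor products are over $\mathbb Z$. $A$ and $B$ are shift equivalent if there exist a positive integer $\ell$ and rectangular nonnegative integer matrices $R,S$ with $AR=RB$, $SA=BS$, $A^\ell=RS$, $B^\ell=SR$. *)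

theory Defs
  imports "Jordan_Normal_Form.Matrix" "HOL-Algebra.Free_Abelian_Groups"
begin

definition nonneg_integral_mat :: "int mat \<Rightarrow> bool"
  where "nonneg_integral_mat A \<longleftrightarrow> (\<forall>i<dim_row A. \<forall>j<dim_col A. 0 \<le> A $$ (i, j))"

definition essential_mat :: "int mat \<Rightarrow> bool"
  where "essential_mat A \<longleftrightarrow>
    (\<forall>i<dim_row A. row A i \<noteq> 0\<^sub>v (dim_col A)) \<and>
    (\<forall>j<dim_col A. col A j \<noteq> 0\<^sub>v (dim_row A))"

definition shift_equivalent :: "int mat \<Rightarrow> int mat \<Rightarrow> bool"
  where "shift_equivalent A B \<longleftrightarrow>
    (\<exists>(l::nat) R S. 0 < l \<and>
       R \<in> carrier_mat (dim_row A) (dim_row B) \<and> S \<in> carrier_mat (dim_row B) (dim_row A) \<and>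
       nonneg_integral_mat R \<and> nonneg_integral_mat S \<and>
       A * R = R * B \<and> S * A = B * S \<and> A ^\<^sub>m l = R * S \<and> B ^\<^sub>m l = S * R)"

text \<open>For a square integer matrix \<open>A\<close> of size \<open>n\<close>: the subgroup \<open>(id - A) \<int>\<^sup>n\<close> of \<open>\<int>\<^sup>n\<close>, the quotient
  group, and the class of a vector in it. The groups of HOL-Algebra are written multiplicatively,
  so the group operation on \<open>\<int>\<^sup>n\<close>, which is vector addition, appears as \<open>\<otimes>\<close>.\<close>

definition id_minus_image :: "int mat \<Rightarrow> int vec set"
  where "id_minus_image A = (\<lambda>x. (1\<^sub>m (dim_row A) - A) *\<^sub>v x) ` carrier_vec (dim_row A)"

definition id_minus_coker :: "int mat \<Rightarrow> int vec set monoid"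
  where "id_minus_coker A = monoid_vec TYPE(int) (dim_row A) Mod id_minus_image A"

definition coker_class :: "int mat \<Rightarrow> int vec \<Rightarrow> int vec set"
  where "coker_class A v = id_minus_image A #>\<^bsub>monoid_vec TYPE(int) (dim_row A)\<^esub> v"

text \<open>The tensor product over \<open>\<int>\<close> of two abelian groups (both written multiplicatively): the free
  abelian group on pairs, which is additive as a type, modulo the bilinearity relations.
  Compatibility with integer scalars follows from biadditivity.\<close>

definition bilinear_relations ::
    "('a, 'm) monoid_scheme \<Rightarrow> ('b, 'n) monoid_scheme \<Rightarrow> ('a \<times> 'b \<Rightarrow>\<^sub>0 int) set"
  where "bilinear_relations G H =
    {frag_of (x \<otimes>\<^bsub>G\<^esub> x', y) - frag_of (x, y) - frag_of (x', y) | x x' y.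
       x \<in> carrier G \<and> x' \<in> carrier G \<and> y \<in> carrier H} \<union>
    {frag_of (x, y \<otimes>\<^bsub>H\<^esub> y') - frag_of (x, y) - frag_of (x, y') | x y y'.
       x \<in> carrier G \<and> y \<in> carrier H \<and> y' \<in> carrier H}"

definition bilinear_subgroup ::
    "('a, 'm) monoid_scheme \<Rightarrow> ('b, 'n) monoid_scheme \<Rightarrow> ('a \<times> 'b \<Rightarrow>\<^sub>0 int) set"
  where "bilinear_subgroup G H =
    generate (free_Abelian_group (carrier G \<times> carrier H)) (bilinear_relations G H)"

definition tensor_group ::
    "('a, 'm) monoid_scheme \<Rightarrow> ('b, 'n) monoid_scheme \<Rightarrow> ('a \<times> 'b \<Rightarrow>\<^sub>0 int) set monoid"
  where "tensor_group G H =
    free_Abelian_group (carrier G \<times> carrier H) Mod bilinear_subgroup G H"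

definition pure_tensor ::
    "('a, 'm) monoid_scheme \<Rightarrow> ('b, 'n) monoid_scheme \<Rightarrow> 'a \<Rightarrow> 'b \<Rightarrow> ('a \<times> 'b \<Rightarrow>\<^sub>0 int) set"
  where "pure_tensor G H x y =
    bilinear_subgroup G H #>\<^bsub>free_Abelian_group (carrier G \<times> carrier H)\<^esub> frag_of (x, y)"

definition coker_tensor :: "int mat \<Rightarrow> (int vec set \<times> int vec set \<Rightarrow>\<^sub>0 int) set monoid"
  where "coker_tensor A = tensor_group (id_minus_coker A) (id_minus_coker (transpose_mat A))"

text \<open>The element \<open>e\<^sub>A\<close>. The product is the sum of the abelian group \<open>coker_tensor A\<close>; basis vectors
  are indexed from \<open>0\<close>.\<close>

definition coker_tensor_elem :: "int mat \<Rightarrow> (int vec set \<times> int vec set \<Rightarrow>\<^sub>0 int) set"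
  where "coker_tensor_elem A =
    (\<Otimes>\<^bsub>coker_tensor A\<^esub> i \<in> {0..<dim_row A}.
       pure_tensor (id_minus_coker A) (id_minus_coker (transpose_mat A))
         (coker_class A (unit_vec (dim_row A) i))
         (coker_class (transpose_mat A) (unit_vec (dim_row A) i)))"

end

theory Submission
  imports Defs
begin

text \<open>Multiplication by \<open>S\<close> and by \<open>R\<^sup>t\<close> induces homomorphisms between the cokernels for \<open>A\<close> and
  \<open>B\<close> and for their transposes. They are invertible, with inverses induced by \<open>R\<close> and \<open>S\<^sup>t\<close>,
  because \<open>A^l = R * S\<close> acts as the identity modulo \<open>(id - A) \<int>\<^sup>N\<close>. The tensor product of these
  isomorphisms sends \<open>e\<^sub>A\<close> to the sum of \<open>[S e\<^sub>i] \<otimes> [R\<^sup>t e\<^sub>i]\<close>; moving \<open>R\<close> to the left factor turns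
  this into the sum of \<open>[S R e\<^sub>k] \<otimes> [e\<^sub>k] = [B^l e\<^sub>k] \<otimes> [e\<^sub>k] = [e\<^sub>k] \<otimes> [e\<^sub>k]\<close>.\<close>

subsection \<open>Finite products in commutative groups\<close>

lemma (in comm_monoid) finprod_interchange:
  assumes "finite I" "finite J" "\<And>i j. i \<in> I \<Longrightarrow> j \<in> J \<Longrightarrow> f i j \<in> carrier G"
  shows "(\<Otimes>i\<in>I. \<Otimes>j\<in>J. f i j) = (\<Otimes>j\<in>J. \<Otimes>i\<in>I. f i j)"
  using assms(1,3)
proof (induction I rule: finite_induct)
  case empty
  then show ?case by simp
next
  case (insert x F)
  have "(\<Otimes>i\<in>insert x F. \<Otimes>j\<in>J. f i j) = (\<Otimes>j\<in>J. f x j) \<otimes> (\<Otimes>i\<in>F. \<Otimes>j\<in>J. f i j)"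
    using insert by (intro finprod_insert) (auto intro!: finprod_closed)
  also have "\<dots> = (\<Otimes>j\<in>J. f x j) \<otimes> (\<Otimes>j\<in>J. \<Otimes>i\<in>F. f i j)"
    using insert by simp
  also have "\<dots> = (\<Otimes>j\<in>J. f x j \<otimes> (\<Otimes>i\<in>F. f i j))"
    using insert by (intro finprod_multf[symmetric]) (auto intro!: finprod_closed)
  also have "\<dots> = (\<Otimes>j\<in>J. \<Otimes>i\<in>insert x F. f i j)"
    using insert by (intro finprod_cong' refl) (auto intro!: finprod_closed)
  finally show ?case .
qed

lemma hom_finprod:
  assumes "comm_group G" "comm_group K" "h \<in> hom G K" "finite I" "f \<in> I \<rightarrow> carrier G"
  shows "h (finprod G f I) = finprod K (\<lambda>i. h (f i)) I"
proof -
  interpret G: comm_group G by fact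
  interpret K: comm_group K by fact
  interpret group_hom G K h
    by unfold_locales (rule assms(3))
  show ?thesis
    using assms(4,5)
  proof (induction I rule: finite_induct)
    case empty
    then show ?case by simp
  next
    case (insert x F)
    then have "f \<in> F \<rightarrow> carrier G" "f x \<in> carrier G" "(\<lambda>i. h (f i)) \<in> F \<rightarrow> carrier K"
      by (auto simp: Pi_iff)
    with insert show ?case by simp
  qed
qed

subsection \<open>Tensor products of abelian groups\<close>

lemma bilinear_relations_subset:
  assumes "group G" "group H"
  shows "bilinear_relations G H \<subseteq> carrier (free_Abelian_group (carrier G \<times> carrier H))"
proof -
  interpret G: group G by fact
  interpret H: group H by fact
  have *: "Poly_Mapping.keys (frag_of a - frag_of b - frag_of c) \<subseteq> S"
    if "a \<in> S" "b \<in> S" "c \<in> S" for a b c :: "'a \<times> 'c" and S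
    using that keys_diff[of "frag_of a - frag_of b" "frag_of c"] keys_diff[of "frag_of a" "frag_of b"]
    by auto
  show ?thesis
  proof
    fix u assume "u \<in> bilinear_relations G H"
    then show "u \<in> carrier (free_Abelian_group (carrier G \<times> carrier H))"
      unfolding bilinear_relations_def carrier_free_Abelian_group_iff
      by (elim UnE CollectE exE conjE; hypsubst; intro *) auto
  qed
qed

lemma normal_bilinear_subgroup:
  assumes "group G" "group H"
  shows "bilinear_subgroup G H \<lhd> free_Abelian_group (carrier G \<times> carrier H)"
proof -
  interpret F: comm_group "free_Abelian_group (carrier G \<times> carrier H)"
    by (rule abelian_free_Abelian_group)
  show ?thesis
    unfolding bilinear_subgroup_def
    by (intro F.subgroup_imp_normal F.generate_is_subgroup bilinear_relations_subset assms)
qed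

lemma comm_group_tensor_group:
  assumes "group G" "group H"
  shows "comm_group (tensor_group G H)"
proof -
  interpret F: comm_group "free_Abelian_group (carrier G \<times> carrier H)"
    by (rule abelian_free_Abelian_group)
  show ?thesis
    unfolding tensor_group_def
    by (intro F.abelian_FactGroup normal_imp_subgroup normal_bilinear_subgroup assms)
qed

lemma pure_tensor_closed:
  assumes "x \<in> carrier G" "y \<in> carrier H"
  shows "pure_tensor G H x y \<in> carrier (tensor_group G H)"
  using assms by (simp add: pure_tensor_def tensor_group_def carrier_FactGroup)

lemma coset_hom_tensor_group:
  assumes "group G" "group H"
  shows "r_coset (free_Abelian_group (carrier G \<times> carrier H)) (bilinear_subgroup G H)
    \<in> hom (free_Abelian_group (carrier G \<times> carrier H)) (tensor_group G H)"
  using normal.r_coset_hom_Mod[OF normal_bilinear_subgroup[OF assms]]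
  by (simp add: tensor_group_def)

text \<open>Both families of bilinearity relations have the shape p - q - r, so this one argument
  yields additivity in either variable: cosets of the subgroup cannot distinguish p from q +
  r.\<close>

lemma pure_tensor_relation:
  assumes "group G" "group H" "frag_of p - frag_of q - frag_of r \<in> bilinear_relations G H"
    and "p \<in> carrier G \<times> carrier H" "q \<in> carrier G \<times> carrier H" "r \<in> carrier G \<times> carrier H"
  shows "pure_tensor G H (fst p) (snd p) =
    pure_tensor G H (fst q) (snd q) \<otimes>\<^bsub>tensor_group G H\<^esub> pure_tensor G H (fst r) (snd r)"
proof -
  let ?F = "free_Abelian_group (carrier G \<times> carrier H)"
  let ?N = "bilinear_subgroup G H"
  interpret N: normal ?N ?F
    by (rule normal_bilinear_subgroup) fact+
  have F: "frag_of p \<in> carrier ?F" "frag_of q \<in> carrier ?F" "frag_of r \<in> carrier ?F"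
    using assms by simp_all
  have "frag_of p - frag_of q - frag_of r \<in> ?N"
    using assms(3) unfolding bilinear_subgroup_def by (rule generate.incl)
  \<comment> \<open>This is the decomposition p = (p - q - r) + (q + r), with the first summand in
    the subgroup.\<close>
  then have "frag_of p \<in> ?N #>\<^bsub>?F\<^esub> (frag_of q + frag_of r)"
    unfolding r_coset_def by force
  then have "?N #>\<^bsub>?F\<^esub> (frag_of q + frag_of r) = ?N #>\<^bsub>?F\<^esub> frag_of p"
    using F N.m_closed[OF F(2,3)] by (intro N.repr_independence N.subgroup_axioms) auto
  then show ?thesis
    using hom_mult[OF coset_hom_tensor_group[OF assms(1,2)] F(2,3)]
    by (simp add: pure_tensor_def)
qed

lemma pure_tensor_mult_left:
  assumes "group G" "group H" "x \<in> carrier G" "x' \<in> carrier G" "y \<in> carrier H"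
  shows "pure_tensor G H (x \<otimes>\<^bsub>G\<^esub> x') y =
    pure_tensor G H x y \<otimes>\<^bsub>tensor_group G H\<^esub> pure_tensor G H x' y"
proof -
  interpret G: group G by fact
  have "frag_of (x \<otimes>\<^bsub>G\<^esub> x', y) - frag_of (x, y) - frag_of (x', y) \<in> bilinear_relations G H"
    unfolding bilinear_relations_def using assms by blast
  from pure_tensor_relation[OF assms(1,2) this] show ?thesis
    using assms by simp
qed

lemma pure_tensor_mult_right:
  assumes "group G" "group H" "x \<in> carrier G" "y \<in> carrier H" "y' \<in> carrier H"
  shows "pure_tensor G H x (y \<otimes>\<^bsub>H\<^esub> y') =
    pure_tensor G H x y \<otimes>\<^bsub>tensor_group G H\<^esub> pure_tensor G H x y'"
proof -
  interpret H: group H by fact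
  have "frag_of (x, y \<otimes>\<^bsub>H\<^esub> y') - frag_of (x, y) - frag_of (x, y') \<in> bilinear_relations G H"
    unfolding bilinear_relations_def using assms by blast
  from pure_tensor_relation[OF assms(1,2) this] show ?thesis
    using assms by simp
qed

text \<open>Existence half of the universal property. The values of \<open>b\<close> on pairs extend
  to the free abelian group; biadditivity says that this extension kills the relations, so it
  factors through the quotient.\<close>

lemma tensor_group_universal:
  assumes "group G" "group H" "comm_group K"
    and closed: "\<And>x y. x \<in> carrier G \<Longrightarrow> y \<in> carrier H \<Longrightarrow> b x y \<in> carrier K"
    and left: "\<And>x x' y. x \<in> carrier G \<Longrightarrow> x' \<in> carrier G \<Longrightarrow> y \<in> carrier H \<Longrightarrow>
      b (x \<otimes>\<^bsub>G\<^esub> x') y = b x y \<otimes>\<^bsub>K\<^esub> b x' y"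
    and right: "\<And>x y y'. x \<in> carrier G \<Longrightarrow> y \<in> carrier H \<Longrightarrow> y' \<in> carrier H \<Longrightarrow>
      b x (y \<otimes>\<^bsub>H\<^esub> y') = b x y \<otimes>\<^bsub>K\<^esub> b x y'"
  obtains h where "h \<in> hom (tensor_group G H) K"
    and "\<And>x y. x \<in> carrier G \<Longrightarrow> y \<in> carrier H \<Longrightarrow> h (pure_tensor G H x y) = b x y"
proof -
  let ?F = "free_Abelian_group (carrier G \<times> carrier H)"
  interpret G: group G by fact
  interpret H: group H by fact
  interpret K: comm_group K by fact
  have "(\<lambda>p. b (fst p) (snd p)) ` (carrier G \<times> carrier H) \<subseteq> carrier K"
    using closed by auto
  then obtain k where k: "k \<in> hom ?F K"
    and k_frag: "\<And>p. p \<in> carrier G \<times> carrier H \<Longrightarrow> k (frag_of p) = b (fst p) (snd p)"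
    by (rule K.free_Abelian_group_universal) blast
  interpret k: group_hom ?F K k
    using k by (simp add: group_hom_def group_hom_axioms_def)
  have rel: "k (frag_of p - frag_of q - frag_of r) = \<one>\<^bsub>K\<^esub>"
    if "p \<in> carrier G \<times> carrier H" "q \<in> carrier G \<times> carrier H" "r \<in> carrier G \<times> carrier H"
      and eq: "b (fst p) (snd p) = b (fst q) (snd q) \<otimes>\<^bsub>K\<^esub> b (fst r) (snd r)" for p q r
  proof -
    have F: "frag_of p \<in> carrier ?F" "frag_of q \<in> carrier ?F" "frag_of r \<in> carrier ?F"
      using that by simp_all
    let ?d = "frag_of p - frag_of q - frag_of r"
    have d: "?d \<in> carrier ?F"
      using F keys_diff[of "frag_of p - frag_of q" "frag_of r"] keys_diff[of "frag_of p" "frag_of q"]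
      by auto
    \<comment> \<open>Instead of computing \<open>k\<close> on a difference, write p as d + (q + r),
      apply \<open>k\<close>, and cancel \<open>k (frag_of p)\<close> on both sides.\<close>
    have "k (frag_of p) = k (?d \<otimes>\<^bsub>?F\<^esub> (frag_of q \<otimes>\<^bsub>?F\<^esub> frag_of r))"
      by simp
    also have "\<dots> = k ?d \<otimes>\<^bsub>K\<^esub> (k (frag_of q) \<otimes>\<^bsub>K\<^esub> k (frag_of r))"
      using d F k.G.m_closed[OF F(2,3)] by (simp only: k.hom_mult)
    finally have "k (frag_of p) = k ?d \<otimes>\<^bsub>K\<^esub> k (frag_of p)"
      using that by (simp add: k_frag)
    then show ?thesis
      using k.hom_closed[OF d] k.hom_closed[OF F(1)] K.r_cancel_one' by metis
  qed
  have "bilinear_relations G H \<subseteq> kernel ?F K k"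
  proof
    fix u assume u: "u \<in> bilinear_relations G H"
    then have "k u = \<one>\<^bsub>K\<^esub>"
      unfolding bilinear_relations_def
      by (elim UnE CollectE exE conjE; hypsubst; intro rel) (simp_all add: left right)
    with u show "u \<in> kernel ?F K k"
      using subsetD[OF bilinear_relations_subset[OF assms(1,2)], of u] unfolding kernel_def by blast
  qed
  then have "bilinear_subgroup G H \<subseteq> kernel ?F K k"
    unfolding bilinear_subgroup_def
    by (intro k.G.generate_subgroup_incl k.subgroup_kernel)
  then obtain h where h: "h \<in> hom (tensor_group G H) K"
    and hk: "\<And>u. u \<in> carrier ?F \<Longrightarrow> h (bilinear_subgroup G H #>\<^bsub>?F\<^esub> u) = k u"
    unfolding tensor_group_def
    by (rule k.FactGroup_universal_kernel[OF normal_bilinear_subgroup[OF assms(1,2)]]) blast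
  show thesis
    by (rule that[OF h]) (simp add: pure_tensor_def hk k_frag)
qed

text \<open>Uniqueness half of the universal property: pure tensors generate. Every element is the
  class of a formal integer combination of pairs, and agreement spreads from single pairs to
  combinations through differences.\<close>

lemma tensor_group_hom_ext:
  assumes "group G" "group H" "group K"
    and h: "h \<in> hom (tensor_group G H) K" and k: "k \<in> hom (tensor_group G H) K"
    and eq: "\<And>x y. x \<in> carrier G \<Longrightarrow> y \<in> carrier H \<Longrightarrow>
      h (pure_tensor G H x y) = k (pure_tensor G H x y)"
    and "t \<in> carrier (tensor_group G H)"
  shows "h t = k t"
proof -
  let ?F = "free_Abelian_group (carrier G \<times> carrier H)"
  let ?c = "\<lambda>u. bilinear_subgroup G H #>\<^bsub>?F\<^esub> u"
  have c: "?c \<in> hom ?F (tensor_group G H)"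
    by (rule coset_hom_tensor_group) fact+
  have T: "group (tensor_group G H)"
    using comm_group_tensor_group[OF assms(1,2)] by (rule comm_group.axioms)
  have hc: "(\<lambda>u. h (?c u)) \<in> hom ?F K" and kc: "(\<lambda>u. k (?c u)) \<in> hom ?F K"
    using hom_compose[OF c h] hom_compose[OF c k] by (simp_all add: o_def)
  interpret hc: group_hom ?F K "\<lambda>u. h (?c u)"
    using hc assms by (simp add: group_hom_def group_hom_axioms_def)
  interpret kc: group_hom ?F K "\<lambda>u. k (?c u)"
    using kc assms by (simp add: group_hom_def group_hom_axioms_def)
  obtain u where u: "u \<in> carrier ?F" "t = ?c u"
    using assms(7) by (auto simp: tensor_group_def carrier_FactGroup)
  have "Poly_Mapping.keys u \<subseteq> carrier G \<times> carrier H"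
    using u by simp
  \<comment> \<open>The support condition is part of the induction claim because the difference case
    offers only the claim for the two terms, and the homomorphism laws require both to lie in the
    free group.\<close>
  then have "Poly_Mapping.keys u \<subseteq> carrier G \<times> carrier H \<and> h (?c u) = k (?c u)"
  proof (induction rule: frag_induction)
    case zero
    then show ?case using hc.hom_one kc.hom_one by simp
  next
    case (one p)
    then show ?case using eq[of "fst p" "snd p"] by (auto simp: pure_tensor_def)
  next
    case (diff a b)
    then have ab: "a \<in> carrier ?F" "b \<in> carrier ?F" by auto
    have "a - b = a \<otimes>\<^bsub>?F\<^esub> inv\<^bsub>?F\<^esub> b"
      using ab by simp
    moreover have "inv\<^bsub>?F\<^esub> b \<in> carrier ?F"
      by (rule hc.G.inv_closed[OF ab(2)])
    ultimately show ?case
      using diff ab hc.hom_mult[of a "inv\<^bsub>?F\<^esub> b"] kc.hom_mult[of a "inv\<^bsub>?F\<^esub> b"]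
        hc.hom_inv[of b] kc.hom_inv[of b] hc.G.m_closed[of a "inv\<^bsub>?F\<^esub> b"]
      by (metis carrier_free_Abelian_group_iff)
  qed
  with u show ?thesis by simp
qed

text \<open>Functoriality of the tensor product: sending (x, y) to the pure tensor of
  \<open>f x\<close> and \<open>g y\<close> is biadditive, so the universal property
  applies.\<close>

lemma tensor_group_map:
  assumes "group G" "group H" "group G'" "group H'"
    and f: "f \<in> hom G G'" and g: "g \<in> hom H H'"
  obtains h where "h \<in> hom (tensor_group G H) (tensor_group G' H')"
    and "\<And>x y. x \<in> carrier G \<Longrightarrow> y \<in> carrier H \<Longrightarrow>
      h (pure_tensor G H x y) = pure_tensor G' H' (f x) (g y)"
proof (rule tensor_group_universal[OF assms(1,2) comm_group_tensor_group[OF assms(3,4)],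
    of "\<lambda>x y. pure_tensor G' H' (f x) (g y)"])
qed (use that in \<open>simp_all add: assms hom_mult[OF f] hom_mult[OF g] hom_in_carrier[OF f]
    hom_in_carrier[OF g] pure_tensor_closed pure_tensor_mult_left pure_tensor_mult_right\<close>)

text \<open>Functoriality is applied to the maps and to their inverses. Both composites fix pure
  tensors, hence are identities by uniqueness.\<close>

lemma tensor_group_iso:
  assumes "group G" "group H" "group G'" "group H'"
    and f: "group_isomorphisms G G' f f'" and g: "group_isomorphisms H H' g g'"
  obtains h where "h \<in> iso (tensor_group G H) (tensor_group G' H')"
    and "\<And>x y. x \<in> carrier G \<Longrightarrow> y \<in> carrier H \<Longrightarrow>
      h (pure_tensor G H x y) = pure_tensor G' H' (f x) (g y)"
proof -
  have f: "f \<in> hom G G'" "f' \<in> hom G' G" "\<And>x. x \<in> carrier G \<Longrightarrow> f' (f x) = x"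
      "\<And>x. x \<in> carrier G' \<Longrightarrow> f (f' x) = x"
    and g: "g \<in> hom H H'" "g' \<in> hom H' H" "\<And>x. x \<in> carrier H \<Longrightarrow> g' (g x) = x"
      "\<And>x. x \<in> carrier H' \<Longrightarrow> g (g' x) = x"
    using f g by (auto simp: group_isomorphisms_def)
  note T = comm_group_tensor_group[OF assms(1,2), THEN comm_group.axioms(2)]
  note T' = comm_group_tensor_group[OF assms(3,4), THEN comm_group.axioms(2)]
  obtain h where h: "h \<in> hom (tensor_group G H) (tensor_group G' H')"
    "\<And>x y. x \<in> carrier G \<Longrightarrow> y \<in> carrier H \<Longrightarrow>
      h (pure_tensor G H x y) = pure_tensor G' H' (f x) (g y)"
    by (rule tensor_group_map[OF assms(1-4) f(1) g(1)]) blast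
  obtain k where k: "k \<in> hom (tensor_group G' H') (tensor_group G H)"
    "\<And>x y. x \<in> carrier G' \<Longrightarrow> y \<in> carrier H' \<Longrightarrow>
      k (pure_tensor G' H' x y) = pure_tensor G H (f' x) (g' y)"
    by (rule tensor_group_map[OF assms(3,4,1,2) f(2) g(2)]) blast
  \<comment> \<open>The composite is compared with the identity, itself a homomorphism, on pure
    tensors.\<close>
  have kh: "k (h t) = t" if "t \<in> carrier (tensor_group G H)" for t
    using tensor_group_hom_ext[OF assms(1,2) T hom_compose[OF h(1) k(1)], of "\<lambda>t. t" t] that
      hom_in_carrier[OF f(1)] hom_in_carrier[OF g(1)]
    by (auto simp: h(2) k(2) f g hom_def)
  have hk: "h (k t) = t" if "t \<in> carrier (tensor_group G' H')" for t
    using tensor_group_hom_ext[OF assms(3,4) T' hom_compose[OF k(1) h(1)], of "\<lambda>t. t" t] that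
      hom_in_carrier[OF f(2)] hom_in_carrier[OF g(2)]
    by (auto simp: h(2) k(2) f g hom_def)
  have "h \<in> iso (tensor_group G H) (tensor_group G' H')"
    by (rule group_isomorphisms_imp_iso[of _ _ _ k])
      (use h k kh hk in \<open>auto simp: group_isomorphisms_def\<close>)
  then show thesis
    using h(2) that by blast
qed

subsection \<open>Homomorphisms on integer vectors\<close>

lemma nat_pow_monoid_vec:
  assumes "v \<in> carrier_vec n"
  shows "v [^]\<^bsub>monoid_vec TYPE(int) n\<^esub> (k::nat) = int k \<cdot>\<^sub>v v"
  using assms
  by (induction k) (auto simp: nat_pow_def monoid_vec_simps algebra_simps)

text \<open>Translates the multiplicative notation: integer powers in the group of vectors are
  scalar multiples, so homomorphisms turn scalars into powers.\<close>

lemma int_pow_monoid_vec: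
  assumes "v \<in> carrier_vec n"
  shows "v [^]\<^bsub>monoid_vec TYPE(int) n\<^esub> (c::int) = c \<cdot>\<^sub>v v"
proof -
  interpret V: comm_group "monoid_vec TYPE(int) n" by (rule comm_group_vec)
  have inv: "inv\<^bsub>monoid_vec TYPE(int) n\<^esub> w = - w" if "w \<in> carrier_vec n" for w
    using that by (intro V.inv_equality) (auto simp: monoid_vec_simps)
  show ?thesis
  proof (cases "c < 0")
    case True
    then have "v [^]\<^bsub>monoid_vec TYPE(int) n\<^esub> c = - (int (nat (- c)) \<cdot>\<^sub>v v)"
      unfolding int_pow_def2 nat_pow_monoid_vec[OF assms] using assms by (subst inv) simp_all
    also have "\<dots> = c \<cdot>\<^sub>v v"
      using True by (intro eq_vecI) auto
    finally show ?thesis .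
  next
    case False
    then show ?thesis
      unfolding int_pow_def2 nat_pow_monoid_vec[OF assms] by simp
  qed
qed

text \<open>Z^n is free on the unit vectors, so a homomorphism is determined by its values there;
  the powers are the coordinates of \<open>v\<close> acting as integer multiples.\<close>

lemma hom_monoid_vec_expand:
  assumes "comm_group K" and h: "h \<in> hom (monoid_vec TYPE(int) n) K" and v: "v \<in> carrier_vec n"
  shows "h v = (\<Otimes>\<^bsub>K\<^esub>i\<in>{0..<n}. h (unit_vec n i) [^]\<^bsub>K\<^esub> (v $ i))"
proof -
  interpret K: comm_group K by fact
  interpret V: comm_group "monoid_vec TYPE(int) n" by (rule comm_group_vec)
  interpret group_hom "monoid_vec TYPE(int) n" K h
    by unfold_locales (rule h)
  have unit: "h (unit_vec n i) \<in> carrier K" for i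
    by (intro hom_closed) (simp add: monoid_vec_simps)
  \<comment> \<open>\<open>t k\<close> keeps the first \<open>k\<close> coordinates of
    \<open>v\<close> and is zero elsewhere. It runs from the zero vector at \<open>k = 0\<close> to
    \<open>v\<close> at \<open>k = n\<close>, gaining one multiple of a unit vector at each
    step.\<close>
  define t where "t k = vec n (\<lambda>i. if i < k then v $ i else 0)" for k
  have t: "t k \<in> carrier_vec n" for k
    by (simp add: t_def)
  have "h (t k) = (\<Otimes>\<^bsub>K\<^esub>i\<in>{0..<k}. h (unit_vec n i) [^]\<^bsub>K\<^esub> (v $ i))" if "k \<le> n" for k
    using that
  proof (induction k)
    case 0
    have "t 0 = \<one>\<^bsub>monoid_vec TYPE(int) n\<^esub>"
      by (auto simp: t_def monoid_vec_simps)
    then show ?case by simp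
  next
    case (Suc k)
    have "t (Suc k) = v $ k \<cdot>\<^sub>v unit_vec n k + t k"
      using Suc.prems by (intro eq_vecI) (auto simp: t_def less_Suc_eq)
    then have "h (t (Suc k)) = h (v $ k \<cdot>\<^sub>v unit_vec n k) \<otimes>\<^bsub>K\<^esub> h (t k)"
      using hom_mult[of "v $ k \<cdot>\<^sub>v unit_vec n k" "t k"] t by (simp add: monoid_vec_simps)
    also have "h (v $ k \<cdot>\<^sub>v unit_vec n k) = h (unit_vec n k) [^]\<^bsub>K\<^esub> (v $ k)"
      using hom_int_pow[of "unit_vec n k" "v $ k"]
      by (simp add: int_pow_monoid_vec monoid_vec_simps)
    finally show ?case
      using Suc unit by (simp add: atLeast0_lessThan_Suc)
  qed
  from this[of n] have "h (t n) = (\<Otimes>\<^bsub>K\<^esub>i\<in>{0..<n}. h (unit_vec n i) [^]\<^bsub>K\<^esub> (v $ i))" by simp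
  moreover have "t n = v" using v by (auto simp: t_def)
  ultimately show ?thesis by simp
qed

lemma mult_mat_vec_hom:
  fixes P :: "int mat"
  assumes "P \<in> carrier_mat m n"
  shows "(\<lambda>v. P *\<^sub>v v) \<in> hom (monoid_vec TYPE(int) n) (monoid_vec TYPE(int) m)"
  using assms by (auto simp: hom_def monoid_vec_simps mult_add_distrib_mat_vec)

text \<open>The adjunction that moves \<open>R\<close> from the second argument to the first. In
  additive notation both sides equal the double sum of R_ik b(S e_i, e_k): the left by expanding R^t
  e_i in the second argument, the right by expanding R e_k in the first.\<close>

lemma bilinear_finprod_unit_vec:
  fixes R S :: "int mat"
  assumes "comm_group K" and R: "R \<in> carrier_mat n m" and S: "S \<in> carrier_mat m n"
    and left: "\<And>y. y \<in> carrier_vec m \<Longrightarrow> (\<lambda>x. b x y) \<in> hom (monoid_vec TYPE(int) m) K"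
    and right: "\<And>x. x \<in> carrier_vec m \<Longrightarrow> b x \<in> hom (monoid_vec TYPE(int) m) K"
  shows "(\<Otimes>\<^bsub>K\<^esub>i\<in>{0..<n}. b (S *\<^sub>v unit_vec n i) (transpose_mat R *\<^sub>v unit_vec n i)) =
    (\<Otimes>\<^bsub>K\<^esub>k\<in>{0..<m}. b ((S * R) *\<^sub>v unit_vec m k) (unit_vec m k))"
proof -
  interpret K: comm_group K by fact
  have closed: "b x y \<in> carrier K" if "x \<in> carrier_vec m" "y \<in> carrier_vec m" for x y
    using hom_in_carrier[OF right[OF that(1)]] that(2) by (simp add: monoid_vec_simps)
  have Su: "S *\<^sub>v unit_vec n i \<in> carrier_vec m" for i
    using S by simp
  \<comment> \<open>The common summand of the two expansions, with the matrix entry appearing as an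
    exponent.\<close>
  define c where "c i k = b (S *\<^sub>v unit_vec n i) (unit_vec m k) [^]\<^bsub>K\<^esub> (R $$ (i, k))" for i k
  have c: "c i k \<in> carrier K" for i k
    unfolding c_def by (intro K.int_pow_closed closed Su) simp
  have "(\<Otimes>\<^bsub>K\<^esub>i\<in>{0..<n}. b (S *\<^sub>v unit_vec n i) (transpose_mat R *\<^sub>v unit_vec n i)) =
    (\<Otimes>\<^bsub>K\<^esub>i\<in>{0..<n}. \<Otimes>\<^bsub>K\<^esub>k\<in>{0..<m}. c i k)"
  proof (rule K.finprod_cong')
    fix i assume i: "i \<in> {0..<n}"
    have Ru: "transpose_mat R *\<^sub>v unit_vec n i \<in> carrier_vec m"
      using R by simp
    have "b (S *\<^sub>v unit_vec n i) (transpose_mat R *\<^sub>v unit_vec n i) =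
      (\<Otimes>\<^bsub>K\<^esub>k\<in>{0..<m}. b (S *\<^sub>v unit_vec n i) (unit_vec m k) [^]\<^bsub>K\<^esub>
        ((transpose_mat R *\<^sub>v unit_vec n i) $ k))"
      by (rule hom_monoid_vec_expand[OF assms(1) right[OF Su] Ru])
    also have "\<dots> = (\<Otimes>\<^bsub>K\<^esub>k\<in>{0..<m}. c i k)"
      using i R by (intro K.finprod_cong' refl Pi_I c) (simp add: c_def)
    finally show "b (S *\<^sub>v unit_vec n i) (transpose_mat R *\<^sub>v unit_vec n i) =
      (\<Otimes>\<^bsub>K\<^esub>k\<in>{0..<m}. c i k)" .
  qed (auto intro!: K.finprod_closed c)
  also have "\<dots> = (\<Otimes>\<^bsub>K\<^esub>k\<in>{0..<m}. \<Otimes>\<^bsub>K\<^esub>i\<in>{0..<n}. c i k)"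
    by (rule K.finprod_interchange) (auto intro: c)
  also have "\<dots> = (\<Otimes>\<^bsub>K\<^esub>k\<in>{0..<m}. b ((S * R) *\<^sub>v unit_vec m k) (unit_vec m k))"
  proof (rule K.finprod_cong')
    fix k assume k: "k \<in> {0..<m}"
    have Ru: "R *\<^sub>v unit_vec m k \<in> carrier_vec n"
      using R by simp
    \<comment> \<open>With the second argument fixed at e_k, precomposing with \<open>S\<close>
      gives a homomorphism on Z^n, which can be expanded along the coordinates R_ik of R
      e_k.\<close>
    have "(\<lambda>v. b (S *\<^sub>v v) (unit_vec m k)) \<in> hom (monoid_vec TYPE(int) n) K"
      using hom_compose[OF mult_mat_vec_hom[OF S] left[of "unit_vec m k"]] by (simp add: o_def)
    from hom_monoid_vec_expand[OF assms(1) this Ru]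
    have "b (S *\<^sub>v (R *\<^sub>v unit_vec m k)) (unit_vec m k) =
      (\<Otimes>\<^bsub>K\<^esub>i\<in>{0..<n}. b (S *\<^sub>v unit_vec n i) (unit_vec m k) [^]\<^bsub>K\<^esub> ((R *\<^sub>v unit_vec m k) $ i))" .
    also have "\<dots> = (\<Otimes>\<^bsub>K\<^esub>i\<in>{0..<n}. c i k)"
      using k R by (intro K.finprod_cong' refl Pi_I c) (simp add: c_def)
    finally show "(\<Otimes>\<^bsub>K\<^esub>i\<in>{0..<n}. c i k) = b ((S * R) *\<^sub>v unit_vec m k) (unit_vec m k)"
      using S R by (simp add: assoc_mult_mat_vec)
  qed (use R S in \<open>auto intro!: closed\<close>)
  finally show ?thesis .
qed

subsection \<open>Cokernels of \<open>id - A\<close>\<close>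

lemma id_minus_mult_mat_vec:
  fixes A :: "int mat"
  assumes "A \<in> carrier_mat n n" "v \<in> carrier_vec n"
  shows "(1\<^sub>m n - A) *\<^sub>v v = v - A *\<^sub>v v"
  using assms by (simp add: minus_mult_distrib_mat_vec[of _ n n])

lemma normal_id_minus_image:
  assumes A: "A \<in> carrier_mat n n"
  shows "id_minus_image A \<lhd> monoid_vec TYPE(int) n"
proof -
  interpret V: comm_group "monoid_vec TYPE(int) n" by (rule comm_group_vec)
  interpret group_hom "monoid_vec TYPE(int) n" "monoid_vec TYPE(int) n" "\<lambda>v. (1\<^sub>m n - A) *\<^sub>v v"
    by unfold_locales (rule mult_mat_vec_hom, use A in auto)
  show ?thesis
    using V.subgroup_imp_normal[OF img_is_subgroup] A
    by (simp add: id_minus_image_def monoid_vec_simps)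
qed

lemma comm_group_id_minus_coker:
  assumes "A \<in> carrier_mat n n"
  shows "comm_group (id_minus_coker A)"
proof -
  interpret V: comm_group "monoid_vec TYPE(int) n" by (rule comm_group_vec)
  show ?thesis
    using V.abelian_FactGroup[OF normal_imp_subgroup[OF normal_id_minus_image[OF assms]]] assms
    by (simp add: id_minus_coker_def)
qed

lemma coker_class_hom:
  assumes "A \<in> carrier_mat n n"
  shows "coker_class A \<in> hom (monoid_vec TYPE(int) n) (id_minus_coker A)"
  using normal.r_coset_hom_Mod[OF normal_id_minus_image[OF assms]] assms
  by (simp add: id_minus_coker_def coker_class_def[abs_def])

lemma coker_class_closed:
  assumes "A \<in> carrier_mat n n" "v \<in> carrier_vec n"
  shows "coker_class A v \<in> carrier (id_minus_coker A)"
  using hom_in_carrier[OF coker_class_hom[OF assms(1)]] assms(2) by (simp add: monoid_vec_simps)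

lemma carrier_id_minus_coker:
  assumes "A \<in> carrier_mat n n"
  shows "carrier (id_minus_coker A) = coker_class A ` carrier_vec n"
  using assms
  by (auto simp: id_minus_coker_def carrier_FactGroup monoid_vec_simps coker_class_def)

text \<open>\<open>A\<close> acts as the identity on its cokernel, since v and A v differ by (id -
  A) v.\<close>

lemma coker_class_mult_mat_vec:
  assumes A: "A \<in> carrier_mat n n" and v: "v \<in> carrier_vec n"
  shows "coker_class A (A *\<^sub>v v) = coker_class A v"
proof -
  interpret N: normal "id_minus_image A" "monoid_vec TYPE(int) n"
    by (rule normal_id_minus_image[OF A])
  have "(1\<^sub>m n - A) *\<^sub>v v \<in> id_minus_image A"
    using A v by (auto simp: id_minus_image_def)
  moreover have "v = (1\<^sub>m n - A) *\<^sub>v v + A *\<^sub>v v"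
    using A v by (intro eq_vecI) (auto simp: id_minus_mult_mat_vec)
  ultimately have "v \<in> id_minus_image A #>\<^bsub>monoid_vec TYPE(int) n\<^esub> (A *\<^sub>v v)"
    unfolding r_coset_def by (auto simp: monoid_vec_simps)
  then show ?thesis
    using N.repr_independence[OF _ _ N.subgroup_axioms] A v
    by (simp add: coker_class_def monoid_vec_simps)
qed

lemma coker_class_pow_mult_mat_vec:
  assumes A: "A \<in> carrier_mat n n" and v: "v \<in> carrier_vec n"
  shows "coker_class A ((A ^\<^sub>m l) *\<^sub>v v) = coker_class A v"
  using v
proof (induction l arbitrary: v)
  case 0
  then show ?case using A by simp
next
  case (Suc l)
  \<comment> \<open>The power splits off its last factor, which acts first; the induction hypothesis
    is therefore used at A v, and \<open>v\<close> must stay arbitrary.\<close>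
  have "(A ^\<^sub>m Suc l) *\<^sub>v v = (A ^\<^sub>m l) *\<^sub>v (A *\<^sub>v v)"
    using A Suc.prems by (simp add: assoc_mult_mat_vec[of _ n n _ n])
  then show ?case
    using Suc A by (simp add: coker_class_mult_mat_vec)
qed

text \<open>The intertwining relation gives P (id - A) = (id - B) P, so \<open>P\<close> maps the
  image of id - A into that of id - B and descends to the quotients.\<close>

lemma id_minus_coker_map:
  assumes A: "A \<in> carrier_mat n n" and B: "B \<in> carrier_mat m m" and P: "P \<in> carrier_mat m n"
    and comm: "P * A = B * P"
  obtains f where "f \<in> hom (id_minus_coker A) (id_minus_coker B)"
    and "\<And>v. v \<in> carrier_vec n \<Longrightarrow> f (coker_class A v) = coker_class B (P *\<^sub>v v)"
proof -
  let ?h = "\<lambda>v. coker_class B (P *\<^sub>v v)"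
  interpret V: comm_group "monoid_vec TYPE(int) n" by (rule comm_group_vec)
  interpret C: comm_group "id_minus_coker B" by (rule comm_group_id_minus_coker[OF B])
  interpret group_hom "monoid_vec TYPE(int) n" "id_minus_coker B" ?h
    using hom_compose[OF mult_mat_vec_hom[OF P] coker_class_hom[OF B]]
    by unfold_locales (simp add: o_def)
  have "id_minus_image A \<subseteq> kernel (monoid_vec TYPE(int) n) (id_minus_coker B) ?h"
  proof
    fix w assume "w \<in> id_minus_image A"
    then obtain x where x: "x \<in> carrier_vec n" and w: "w = (1\<^sub>m n - A) *\<^sub>v x"
      using A by (auto simp: id_minus_image_def)
    have wc: "w \<in> carrier_vec n" using A x w by (simp add: id_minus_mult_mat_vec)
    \<comment> \<open>Applying \<open>?h\<close> to this decomposition suffices: \<open>?h\<close>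
      takes equal values at x and A x, because \<open>P\<close> intertwines and \<open>B\<close>
      acts trivially on its cokernel, so cancellation makes \<open>?h w\<close> trivial.\<close>
    have "x = w + A *\<^sub>v x"
      using A x w by (intro eq_vecI) (auto simp: id_minus_mult_mat_vec)
    then have "?h x = ?h w \<otimes>\<^bsub>id_minus_coker B\<^esub> ?h (A *\<^sub>v x)"
      using hom_mult[of w "A *\<^sub>v x"] wc A x by (simp add: monoid_vec_simps)
    also have "P *\<^sub>v (A *\<^sub>v x) = B *\<^sub>v (P *\<^sub>v x)"
      using A B P x comm assoc_mult_mat_vec[OF P A x] assoc_mult_mat_vec[OF B P x] by simp
    also have "coker_class B (B *\<^sub>v (P *\<^sub>v x)) = ?h x"
      using P x by (intro coker_class_mult_mat_vec[OF B]) auto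
    finally have "?h w = \<one>\<^bsub>id_minus_coker B\<^esub>"
      using hom_closed[of w] hom_closed[of x] wc x C.r_cancel_one'
      by (metis monoid_vec_simps(2))
    with wc show "w \<in> kernel (monoid_vec TYPE(int) n) (id_minus_coker B) ?h"
      by (simp add: kernel_def monoid_vec_simps)
  qed
  then obtain f where "f \<in> hom (monoid_vec TYPE(int) n Mod id_minus_image A) (id_minus_coker B)"
    "\<And>v. v \<in> carrier (monoid_vec TYPE(int) n) \<Longrightarrow>
      f (id_minus_image A #>\<^bsub>monoid_vec TYPE(int) n\<^esub> v) = ?h v"
    by (rule FactGroup_universal_kernel[OF normal_id_minus_image[OF A]]) blast
  then show thesis
    using A by (intro that[of f]) (auto simp: id_minus_coker_def coker_class_def monoid_vec_simps)
qed

text \<open>The composites of the induced maps come from A^l and B^l, and powers of a matrix act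
  trivially on its cokernel; hence the maps are mutually inverse.\<close>

lemma id_minus_coker_isomorphisms:
  assumes A: "A \<in> carrier_mat n n" and B: "B \<in> carrier_mat m m"
    and P: "P \<in> carrier_mat m n" and Q: "Q \<in> carrier_mat n m"
    and PA: "P * A = B * P" and QB: "Q * B = A * Q"
    and QP: "Q * P = A ^\<^sub>m l" and PQ: "P * Q = B ^\<^sub>m l"
  obtains f g where "group_isomorphisms (id_minus_coker A) (id_minus_coker B) f g"
    and "\<And>v. v \<in> carrier_vec n \<Longrightarrow> f (coker_class A v) = coker_class B (P *\<^sub>v v)"
proof -
  obtain f where f: "f \<in> hom (id_minus_coker A) (id_minus_coker B)"
    "\<And>v. v \<in> carrier_vec n \<Longrightarrow> f (coker_class A v) = coker_class B (P *\<^sub>v v)"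
    by (rule id_minus_coker_map[OF A B P PA]) blast
  obtain g where g: "g \<in> hom (id_minus_coker B) (id_minus_coker A)"
    "\<And>v. v \<in> carrier_vec m \<Longrightarrow> g (coker_class B v) = coker_class A (Q *\<^sub>v v)"
    by (rule id_minus_coker_map[OF B A Q QB]) blast
  have "g (f x) = x" if "x \<in> carrier (id_minus_coker A)" for x
    using that P Q
    by (auto simp: carrier_id_minus_coker[OF A] f g assoc_mult_mat_vec[symmetric, OF Q P] QP
        coker_class_pow_mult_mat_vec[OF A])
  moreover have "f (g x) = x" if "x \<in> carrier (id_minus_coker B)" for x
    using that P Q
    by (auto simp: carrier_id_minus_coker[OF B] f g assoc_mult_mat_vec[symmetric, OF P Q] PQ
        coker_class_pow_mult_mat_vec[OF B])
  ultimately show thesis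
    using f g by (intro that[of f g]) (auto simp: group_isomorphisms_def)
qed

section \<open>Powers and transposes of matrices\<close>

lemma pow_mat_commute:
  fixes A :: "'a :: semiring_1 mat"
  assumes "A \<in> carrier_mat n n"
  shows "A * A ^\<^sub>m l = A ^\<^sub>m l * A"
proof (induction l)
  case 0
  then show ?case using assms by simp
next
  case (Suc l)
  have "A * A ^\<^sub>m Suc l = (A * A ^\<^sub>m l) * A"
    using assms by (simp add: assoc_mult_mat[of _ n n _ n _ n])
  then show ?case using Suc by simp
qed

text \<open>Transposition reverses products and so puts the new factor on the left, whereas matrix
  powers grow on the right; commutation of a matrix with its powers reconciles the two.\<close>

lemma transpose_pow_mat:
  fixes A :: "'a :: comm_semiring_1 mat"
  assumes "A \<in> carrier_mat n n"
  shows "transpose_mat (A ^\<^sub>m l) = transpose_mat A ^\<^sub>m l"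
proof (induction l)
  case 0
  then show ?case using assms by simp
next
  case (Suc l)
  have "transpose_mat (A ^\<^sub>m Suc l) = transpose_mat A * transpose_mat A ^\<^sub>m l"
    using assms Suc transpose_mult[of "A ^\<^sub>m l" n n A n] by simp
  then show ?case
    using assms pow_mat_commute[of "transpose_mat A" n l] by simp
qed

section \<open>Invariance of the tensor product and its distinguished element\<close>

theorem proposition5p8:
  fixes A B :: "int mat" and N M :: nat
  assumes "A \<in> carrier_mat N N" and "nonneg_integral_mat A" and "essential_mat A"
    and "B \<in> carrier_mat M M" and "nonneg_integral_mat B" and "essential_mat B"
    and "shift_equivalent A B"
  shows "\<exists>\<phi> \<in> iso (coker_tensor A) (coker_tensor B).
           \<phi> (coker_tensor_elem A) = coker_tensor_elem B"
proof -
  note A = assms(1) and B = assms(4)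
  obtain l R S where R: "R \<in> carrier_mat N M" and S: "S \<in> carrier_mat M N"
    and AR: "A * R = R * B" and SA: "S * A = B * S" and RS: "A ^\<^sub>m l = R * S" and SR: "B ^\<^sub>m l = S * R"
    using assms unfolding shift_equivalent_def by auto
  let ?At = "transpose_mat A" and ?Bt = "transpose_mat B"
  let ?Rt = "transpose_mat R" and ?St = "transpose_mat S"
  have At: "?At \<in> carrier_mat N N" and Bt: "?Bt \<in> carrier_mat M M"
    and Rt: "?Rt \<in> carrier_mat M N" and St: "?St \<in> carrier_mat N M"
    using A B R S by auto
  \<comment> \<open>Transposing reverses the intertwining relations, so from the side of
    \<open>A\<close> to the side of \<open>B\<close> it is R^t that acts on the transposed
    cokernels, while \<open>S\<close> acts on the original ones.\<close>
  have t: "?Rt * ?At = ?Bt * ?Rt" "?St * ?Bt = ?At * ?St"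
    "?St * ?Rt = ?At ^\<^sub>m l" "?Rt * ?St = ?Bt ^\<^sub>m l"
    using arg_cong[OF AR, of transpose_mat] arg_cong[OF SA, of transpose_mat]
      arg_cong[OF RS, of transpose_mat] arg_cong[OF SR, of transpose_mat]
    by (simp_all add: transpose_mult[OF A R] transpose_mult[OF R B] transpose_mult[OF S A]
        transpose_mult[OF B S] transpose_mult[OF R S] transpose_mult[OF S R]
        transpose_pow_mat[OF A] transpose_pow_mat[OF B])
  let ?C = "id_minus_coker A" and ?Ct = "id_minus_coker ?At"
  let ?D = "id_minus_coker B" and ?Dt = "id_minus_coker ?Bt"
  have gr: "group ?C" "group ?Ct" "group ?D" "group ?Dt"
    using A B At Bt by (auto intro!: comm_group.axioms(2) comm_group_id_minus_coker)
  obtain f f' where f: "group_isomorphisms ?C ?D f f'"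
    "\<And>v. v \<in> carrier_vec N \<Longrightarrow> f (coker_class A v) = coker_class B (S *\<^sub>v v)"
    by (rule id_minus_coker_isomorphisms[OF A B S R SA AR[symmetric] RS[symmetric] SR[symmetric]]) blast
  obtain g g' where g: "group_isomorphisms ?Ct ?Dt g g'"
    "\<And>v. v \<in> carrier_vec N \<Longrightarrow> g (coker_class ?At v) = coker_class ?Bt (?Rt *\<^sub>v v)"
    by (rule id_minus_coker_isomorphisms[OF At Bt Rt St t]) blast
  obtain h where h: "h \<in> iso (coker_tensor A) (coker_tensor B)"
    and h_pure: "\<And>x y. x \<in> carrier ?C \<Longrightarrow> y \<in> carrier ?Ct \<Longrightarrow>
      h (pure_tensor ?C ?Ct x y) = pure_tensor ?D ?Dt (f x) (g y)"
    unfolding coker_tensor_def by (rule tensor_group_iso[OF gr f(1) g(1)]) blast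
  have T: "comm_group (coker_tensor A)" and T': "comm_group (coker_tensor B)"
    unfolding coker_tensor_def by (intro comm_group_tensor_group gr)+
  interpret T': comm_group "coker_tensor B" by (rule T')
  \<comment> \<open>The canonical pairing pulled back along the quotient maps to Z^M in both
    variables, so that the adjunction for vectors can be applied to it.\<close>
  define b where "b x y = pure_tensor ?D ?Dt (coker_class B x) (coker_class ?Bt y)" for x y
  note B_class = coker_class_closed[OF B] coker_class_closed[OF Bt]
  have b_closed: "b x y \<in> carrier (coker_tensor B)" if "x \<in> carrier_vec M" "y \<in> carrier_vec M" for x y
    unfolding b_def coker_tensor_def using that by (intro pure_tensor_closed B_class)
  have class_add: "coker_class B (x + y) = coker_class B x \<otimes>\<^bsub>?D\<^esub> coker_class B y"
    "coker_class ?Bt (x + y) = coker_class ?Bt x \<otimes>\<^bsub>?Dt\<^esub> coker_class ?Bt y"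
    if "x \<in> carrier_vec M" "y \<in> carrier_vec M" for x y
    using hom_mult[OF coker_class_hom[OF B], of x y] hom_mult[OF coker_class_hom[OF Bt], of x y] that
    by (simp_all add: monoid_vec_simps)
  have left: "(\<lambda>x. b x y) \<in> hom (monoid_vec TYPE(int) M) (coker_tensor B)"
    if "y \<in> carrier_vec M" for y
    using that b_closed
    by (auto simp: hom_def monoid_vec_simps)
      (simp_all add: b_def class_add coker_tensor_def pure_tensor_mult_left gr B_class)
  have right: "b x \<in> hom (monoid_vec TYPE(int) M) (coker_tensor B)"
    if "x \<in> carrier_vec M" for x
    using that b_closed
    by (auto simp: hom_def monoid_vec_simps)
      (simp_all add: b_def class_add coker_tensor_def pure_tensor_mult_right gr B_class)
  have "h (coker_tensor_elem A) = (\<Otimes>\<^bsub>coker_tensor B\<^esub>i\<in>{0..<N}. h (pure_tensor ?C ?Ct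
      (coker_class A (unit_vec N i)) (coker_class ?At (unit_vec N i))))"
    unfolding coker_tensor_elem_def using A At h
    by (simp, intro hom_finprod T T')
      (auto simp: iso_def coker_tensor_def intro!: pure_tensor_closed coker_class_closed)
  also have "\<dots> = (\<Otimes>\<^bsub>coker_tensor B\<^esub>i\<in>{0..<N}. b (S *\<^sub>v unit_vec N i) (?Rt *\<^sub>v unit_vec N i))"
    using S Rt
    by (intro T'.finprod_cong' refl Pi_I b_closed)
      (simp_all add: h_pure coker_class_closed[OF A] coker_class_closed[OF At] f g b_def)
  \<comment> \<open>\<open>R\<close> passes from the second tensor factor to the first, where it
    meets \<open>S\<close>.\<close>
  also have "\<dots> = (\<Otimes>\<^bsub>coker_tensor B\<^esub>k\<in>{0..<M}. b ((S * R) *\<^sub>v unit_vec M k) (unit_vec M k))"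
    by (rule bilinear_finprod_unit_vec[OF T' R S left right])
  \<comment> \<open>S R is B^l, which does not change the class of e_k in the cokernel of id -
    B.\<close>
  also have "\<dots> = coker_tensor_elem B"
    using B by (simp add: coker_tensor_elem_def SR[symmetric] b_def coker_class_pow_mult_mat_vec[OF B])
  finally show ?thesis
    using h by blast
qed

end
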